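(* For a linear map $\Omega:\mathbb{F}[x]\to\mathbb{F}[x]$ let $\psi_2:\mathbb{F}[x]\times H_3\to\mathbb{F}[x]$ be the bilinear map with $\psi_2(p,\overline{1})=p$, $\psi_2(p,\overline{x})=\Omega(p)$, $\psi_2(p,\frac{\overline{\delta}}{\delta x})=\frac{\delta}{\delta x}p$. Suppose $\psi_2$ makes $\mathbb{F}[x]$ an $H_3$-module, and let $L$ be a Leibniz algebra with $L/I\cong H_3$ and such that the $H_3$-module $I$ is isomorphic to $(\mathbb{F}[x],\psi_2)$. Then $L$ admits a basis $\{\overline{1},\overline{x},\frac{\overline{\delta}}{\delta x}\}\,\dot\cup\,\{x^i:i\in\mathbb{N}\cup\{0\}\}$ in which the multiplication table is $$[x^i,\overline{1}]=x^i,\quad [x^i,\overline{x}]=\Omega(x^i),\quad [x^i,\tfrac{\overline{\delta}}{\delta x}]=i\,x^{i-1},\quad [\overline{x},\tfrac{\overline{\delta}}{\delta x}]=\overline{1},\quad [\tfrac{\overline{\delta}}{\delta x},\overline{x}]=-\overline{1},$$ where all omitted products of basis elements are zero and $\Omega$ satisfies $$\Omega(x^i)=x^{i+1}+\sum_{k=0}^{i}c_k\binom{i}{k}x^{i-k}\qquad (i\in\mathbb{N}\cup\{0\})$$ for some fixed sequence $\{c_k\}_{k\in\mathbb{N}\cup\{0\}}$ in $\mathbb{F}$.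
   Context: $\mathbb{F}$ is an algebraically closed field of characteristic zero. A Leibniz algebra is an $\mathbb{F}$-vector space $L$ with a bilinear product $[\cdot,\cdot]$ satisfying $[[y,z],x]=[[y,x],z]+[y,[z,x]]$ for all $x,y,z\in L$. $I$ denotes the ideal of $L$ generated by $\{[x,x]:x\in L\}$; it satisfies $[L,I]=0$, the quotient $L/I$ is a Lie algebra, and $I$ is a (right) $L/I$-module via $(i,[x])\mapsto [i,x]$. A (right) module $M$ over a Lie algebra $\mathfrak g$ satisfies $m\cdot[a,b]=(m\cdot a)\cdot b-(m\cdot b)\cdot a$. $H_3$ is the Heisenberg Lie algebra with basis $\{\overline{1},\overline{x},\frac{\overline{\delta}}{\delta x}\}$ and nonzero products $[\overline{x},\frac{\overline{\delta}}{\delta x}]=-[\frac{\overline{\delta}}{\delta x},\overline{x}]=\overline{1}$. $\frac{\delta}{\delta x}$ is the usual derivative on $\mathbb{F}[x]$. In the table, $\Omega(x^i)$ is expanded linearly in the basis elements $x^j$ of $I$. *)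

theory Defs
  imports "HOL-Analysis.Analysis" "HOL-Computational_Algebra.Polynomial"
begin

definition bilinear_over ::
  "('f::field \<Rightarrow> 'a::ab_group_add \<Rightarrow> 'a) \<Rightarrow> ('f \<Rightarrow> 'b::ab_group_add \<Rightarrow> 'b) \<Rightarrow>
   ('f \<Rightarrow> 'c::ab_group_add \<Rightarrow> 'c) \<Rightarrow> ('a \<Rightarrow> 'b \<Rightarrow> 'c) \<Rightarrow> bool" where
  "bilinear_over sa sb sc f \<longleftrightarrow>
     (\<forall>x. Vector_Spaces.linear sb sc (f x)) \<and> (\<forall>y. Vector_Spaces.linear sa sc (\<lambda>x. f x y))"

locale leibniz_algebra = vector_space scale
  for scale :: "'f::field \<Rightarrow> 'l::ab_group_add \<Rightarrow> 'l" +
  fixes br :: "'l \<Rightarrow> 'l \<Rightarrow> 'l"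
  assumes bilinear_br: "bilinear_over scale scale scale br"
    and leibniz: "br (br y z) x = br (br y x) z + br y (br z x)"
begin

lemma br_simps:
  "br (x + y) z = br x z + br y z" "br z (x + y) = br z x + br z y"
  "br (scale c x) z = scale c (br x z)" "br z (scale c x) = scale c (br z x)"
  "br 0 z = 0" "br z 0 = 0"
proof -
  have l: "Vector_Spaces.linear scale scale (br x)"
    and r: "Vector_Spaces.linear scale scale (\<lambda>y. br y x)" for x
    using bilinear_br by (auto simp: bilinear_over_def)
  show a: "br (x + y) z = br x z + br y z" "br z (x + y) = br z x + br z y"
    "br (scale c x) z = scale c (br x z)" "br z (scale c x) = scale c (br z x)" for x y z c
    using l[of z] r[of z] by (auto simp: Vector_Spaces.linear_iff)
  show "br 0 z = 0" "br z 0 = 0"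
    using a(3)[of 0 0 z] a(4)[of z 0 0] by auto
qed

definition ideal :: "'l set \<Rightarrow> bool" where
  "ideal J \<longleftrightarrow> subspace J \<and> (\<forall>j\<in>J. \<forall>x. br j x \<in> J \<and> br x j \<in> J)"

definition leib :: "'l set" where
  "leib = ideal hull {br x x | x. True}"

lemma ideal_leib: "ideal leib"
  unfolding leib_def
  by (rule hull_in) (auto simp: ideal_def subspace_def)

lemma br_self_in_leib: "br x x \<in> leib"
  unfolding leib_def by (rule hull_inc) auto

lemma br_leib: "i \<in> leib \<Longrightarrow> br x i = 0"
proof -
  assume "i \<in> leib"
  have "ideal {z. \<forall>x. br x z = 0}"
  proof -
    have "br y (br z x) = 0 \<and> br y (br x z) = 0" if "\<forall>x. br x z = 0" for x y z
      using leibniz[of y z x] leibniz[of y x z] that by (simp add: br_simps)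
    then show ?thesis
      by (auto simp: ideal_def subspace_def br_simps)
  qed
  moreover have "br y (br x x) = 0" for x y
    using leibniz[of y x x] by simp
  ultimately have "leib \<subseteq> {z. \<forall>x. br x z = 0}"
    unfolding leib_def by (intro hull_minimal) auto
  with \<open>i \<in> leib\<close> show ?thesis by auto
qed

definition coset :: "'l \<Rightarrow> 'l set" where
  "coset x = {x + i | i. i \<in> leib}"

definition quot :: "'l set set" where
  "quot = range coset"

definition quot_add :: "'l set \<Rightarrow> 'l set \<Rightarrow> 'l set" where
  "quot_add A B = {a + b | a b. a \<in> A \<and> b \<in> B}"

text \<open>Adding \<^term>\<open>leib\<close> turns the elementwise scalar multiple (degenerate for scalar 0) and
  product into full cosets.\<close>

definition quot_scale :: "'f \<Rightarrow> 'l set \<Rightarrow> 'l set" where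
  "quot_scale c A = {scale c a + i | a i. a \<in> A \<and> i \<in> leib}"

definition quot_br :: "'l set \<Rightarrow> 'l set \<Rightarrow> 'l set" where
  "quot_br A B = {br a b + i | a b i. a \<in> A \<and> b \<in> B \<and> i \<in> leib}"

text \<open>Well-defined because \<^term>\<open>leib\<close> annihilates from the right (\<open>br_leib\<close>);
  see \<open>quot_act_coset\<close> below.\<close>

definition quot_act :: "'l \<Rightarrow> 'l set \<Rightarrow> 'l" where
  "quot_act i A = (THE j. \<forall>x\<in>A. j = br i x)"

lemma leib_closed:
  "0 \<in> leib" "i \<in> leib \<Longrightarrow> j \<in> leib \<Longrightarrow> i + j \<in> leib" "i \<in> leib \<Longrightarrow> scale c i \<in> leib"
  "i \<in> leib \<Longrightarrow> br i x \<in> leib" "i \<in> leib \<Longrightarrow> br x i \<in> leib"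
  using ideal_leib by (auto simp: ideal_def subspace_def)

lemma quot_add_coset: "quot_add (coset x) (coset y) = coset (x + y)"
proof
  show "quot_add (coset x) (coset y) \<subseteq> coset (x + y)"
  proof
    fix z assume "z \<in> quot_add (coset x) (coset y)"
    then obtain i j where "z = (x + i) + (y + j)" and ij: "i \<in> leib" "j \<in> leib"
      unfolding quot_add_def coset_def by blast
    then have "z = (x + y) + (i + j)" by (simp add: algebra_simps)
    with ij show "z \<in> coset (x + y)"
      unfolding coset_def using leib_closed(2) by blast
  qed
  show "coset (x + y) \<subseteq> quot_add (coset x) (coset y)"
  proof
    fix z assume "z \<in> coset (x + y)"
    then obtain i where i: "i \<in> leib" and "z = x + y + i"
      unfolding coset_def by blast
    then have z: "z = (x + 0) + (y + i)" by (simp add: add.assoc)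
    show "z \<in> quot_add (coset x) (coset y)"
      unfolding quot_add_def coset_def using i z leib_closed(1) by blast
  qed
qed

lemma quot_scale_coset: "quot_scale c (coset x) = coset (scale c x)"
proof
  show "quot_scale c (coset x) \<subseteq> coset (scale c x)"
  proof
    fix z assume "z \<in> quot_scale c (coset x)"
    then obtain i j where "z = scale c (x + i) + j" and ij: "i \<in> leib" "j \<in> leib"
      unfolding quot_scale_def coset_def by blast
    then have "z = scale c x + (scale c i + j)" by (simp add: algebra_simps)
    with ij show "z \<in> coset (scale c x)"
      unfolding coset_def using leib_closed(2,3) by blast
  qed
  show "coset (scale c x) \<subseteq> quot_scale c (coset x)"
  proof
    fix z assume "z \<in> coset (scale c x)"
    then obtain i where i: "i \<in> leib" and z: "z = scale c (x + 0) + i"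
      by (auto simp: coset_def)
    show "z \<in> quot_scale c (coset x)"
      unfolding quot_scale_def coset_def using i z leib_closed(1) by blast
  qed
qed

lemma quot_br_coset: "quot_br (coset x) (coset y) = coset (br x y)"
proof
  show "quot_br (coset x) (coset y) \<subseteq> coset (br x y)"
  proof
    fix z assume "z \<in> quot_br (coset x) (coset y)"
    then obtain i j k where "z = br (x + i) (y + j) + k"
      and ij: "i \<in> leib" "j \<in> leib" "k \<in> leib"
      unfolding quot_br_def coset_def by blast
    then have "z = br x y + (br i y + k)" by (simp add: br_simps br_leib algebra_simps)
    with ij show "z \<in> coset (br x y)"
      unfolding coset_def using leib_closed(2,4) by blast
  qed
  show "coset (br x y) \<subseteq> quot_br (coset x) (coset y)"
  proof
    fix z assume "z \<in> coset (br x y)"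
    then obtain i where i: "i \<in> leib" and z: "z = br (x + 0) (y + 0) + i"
      by (auto simp: coset_def)
    show "z \<in> quot_br (coset x) (coset y)"
      unfolding quot_br_def coset_def using i z leib_closed(1) by blast
  qed
qed

lemma quot_act_coset: "quot_act i (coset x) = br i x"
  unfolding quot_act_def
proof (rule the_equality)
  have eq: "br i y = br i x" if y: "y \<in> coset x" for y
  proof -
    obtain j where "j \<in> leib" "y = x + j"
      using y unfolding coset_def by blast
    then show ?thesis by (simp add: br_simps(2) br_leib)
  qed
  then show "\<forall>y\<in>coset x. br i x = br i y" by simp
  have "x \<in> coset x"
    unfolding coset_def
    by (intro CollectI exI[of _ 0] conjI) (simp_all add: leib_closed(1))
  then show "j = br i x" if "\<forall>y\<in>coset x. j = br i y" for j
    using that by blast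
qed

definition quot_iso ::
  "('f \<Rightarrow> 'g::ab_group_add \<Rightarrow> 'g) \<Rightarrow> ('g \<Rightarrow> 'g \<Rightarrow> 'g) \<Rightarrow> ('l set \<Rightarrow> 'g) \<Rightarrow> bool" where
  "quot_iso scale_g br_g \<phi> \<longleftrightarrow>
     bij_betw \<phi> quot UNIV \<and>
     (\<forall>A\<in>quot. \<forall>B\<in>quot. \<phi> (quot_add A B) = \<phi> A + \<phi> B) \<and>
     (\<forall>c. \<forall>A\<in>quot. \<phi> (quot_scale c A) = scale_g c (\<phi> A)) \<and>
     (\<forall>A\<in>quot. \<forall>B\<in>quot. \<phi> (quot_br A B) = br_g (\<phi> A) (\<phi> B))"

text \<open>The action on \<^term>\<open>leib\<close> of a Lie algebra identified with the quotient via \<open>\<phi>\<close>.\<close>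

definition induced_act :: "('l set \<Rightarrow> 'g) \<Rightarrow> 'l \<Rightarrow> 'g \<Rightarrow> 'l" where
  "induced_act \<phi> i h = quot_act i (inv_into quot \<phi> h)"

definition leib_module_iso ::
  "('l set \<Rightarrow> 'g) \<Rightarrow> ('f \<Rightarrow> 'm::ab_group_add \<Rightarrow> 'm) \<Rightarrow> ('m \<Rightarrow> 'g \<Rightarrow> 'm) \<Rightarrow> ('l \<Rightarrow> 'm) \<Rightarrow> bool" where
  "leib_module_iso \<phi> scale_m act \<theta> \<longleftrightarrow>
     bij_betw \<theta> leib UNIV \<and>
     (\<forall>i\<in>leib. \<forall>j\<in>leib. \<theta> (i + j) = \<theta> i + \<theta> j) \<and>
     (\<forall>c. \<forall>i\<in>leib. \<theta> (scale c i) = scale_m c (\<theta> i)) \<and>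
     (\<forall>i\<in>leib. \<forall>h. \<theta> (induced_act \<phi> i h) = act (\<theta> i) h)"

end

locale lie_algebra = vector_space scale
  for scale :: "'f::field \<Rightarrow> 'g::ab_group_add \<Rightarrow> 'g" +
  fixes br :: "'g \<Rightarrow> 'g \<Rightarrow> 'g"
  assumes bilinear_br: "bilinear_over scale scale scale br"
    and br_self: "br x x = 0"
    and jacobi: "br x (br y z) + br y (br z x) + br z (br x y) = 0"

locale right_lie_module = lie_algebra scale br + mod: vector_space scale_m
  for scale :: "'f::field \<Rightarrow> 'g::ab_group_add \<Rightarrow> 'g" and br
    and scale_m :: "'f \<Rightarrow> 'm::ab_group_add \<Rightarrow> 'm" +
  fixes act :: "'m \<Rightarrow> 'g \<Rightarrow> 'm"
  assumes bilinear_act: "bilinear_over scale_m scale scale_m act"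
    and act_br: "act m (br a b) = act (act m a) b - act (act m b) a"

text \<open>\<open>H\<^sub>3\<close> on coordinate vectors: the components 1, 2, 3 are the coefficients of
  \<open>1\<close>, \<open>x\<close> and \<open>\<delta>/\<delta>x\<close>.\<close>

definition heis_br :: "'f::field ^ 3 \<Rightarrow> 'f ^ 3 \<Rightarrow> 'f ^ 3" where
  "heis_br u v = vector [u $ 2 * v $ 3 - u $ 3 * v $ 2, 0, 0]"

lemma heis_br_basis:
  "heis_br (axis 2 1) (axis 3 1) = axis 1 (1::'f::field)"
  "heis_br (axis 3 1) (axis 2 1) = - axis 1 (1::'f)"
  "heis_br (axis 1 1) v = 0" "heis_br v (axis 1 1) = (0::'f^3)"
  "heis_br v v = (0::'f^3)"
  by (auto simp: heis_br_def vec_eq_iff forall_3 axis_def)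

lemma lie_algebra_heis: "lie_algebra ((*s)) (heis_br :: 'f::field ^ 3 \<Rightarrow> _)"
  by unfold_locales
    (auto simp: bilinear_over_def Vector_Spaces.linear_iff vec.vector_space_axioms
      heis_br_def vec_eq_iff forall_3 algebra_simps)

definition psi2 :: "('f::field poly \<Rightarrow> 'f poly) \<Rightarrow> 'f poly \<Rightarrow> 'f ^ 3 \<Rightarrow> 'f poly" where
  "psi2 \<Omega> p h = smult (h $ 1) p + smult (h $ 2) (\<Omega> p) + smult (h $ 3) (pderiv p)"

lemma psi2_basis:
  "psi2 \<Omega> p (axis 1 1) = p" "psi2 \<Omega> p (axis 2 1) = \<Omega> p" "psi2 \<Omega> p (axis 3 1) = pderiv p"
  by (simp_all add: psi2_def axis_def)

lemma vector_space_poly: "vector_space (smult :: 'f::field \<Rightarrow> _)"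
  by unfold_locales (auto simp: smult_add_right smult_add_left)

lemma bilinear_psi2:
  assumes "Vector_Spaces.linear smult smult \<Omega>"
  shows "bilinear_over smult ((*s)) smult (psi2 \<Omega>)"
  using assms
  by (auto simp: bilinear_over_def Vector_Spaces.linear_iff vec.vector_space_axioms
      psi2_def pderiv_add pderiv_smult smult_add_right smult_add_left mult.commute)

end

(*
  The Heisenberg relation says that the commutator of the derivation D with Omega is the identity,
  as it is for multiplication by x. Hence Omega - x commutes with D, so integrating from degree to
  degree determines it by the constant terms c_k of the images of the x^k.

  For the table, 1 acts as the identity on the Leibniz kernel I and is central modulo I, so
  subtracting [z,1] from a lift z makes it right-annihilated by the lift of 1. The elements
  annihilated in this way absorb products from the right and meet I only in 0; hence every
  relation of the quotient between lifts of x and d/dx holds exactly, once [x, d/dx] is taken as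
  the lift of 1.
*)

theory Submission
  imports Defs
begin

section \<open>Linear operators on polynomials and their commutator with the derivation\<close>

lemma poly_eqI_pderiv:
  fixes p q :: "'a::{idom, ring_char_0} poly"
  assumes "pderiv p = pderiv q" and "coeff p 0 = coeff q 0"
  shows "p = q"
proof -
  have "pderiv (p - q) = 0"
    using assms(1) by (simp add: pderiv_diff)
  then obtain a where "p - q = [:a:]"
    using pderiv_iszero by blast
  moreover have "coeff (p - q) 0 = 0"
    using assms(2) by simp
  ultimately show ?thesis by simp
qed

text \<open>Such a \<open>T\<close> is the series of the c_k D^k / k! in the derivation D. The
  derivative of T(x^(i+1)) is (i+1) T(x^i), known by induction; in characteristic zero this leaves
  only the constant term free, and that is c_(i+1) by definition.\<close>

lemma commutes_pderiv_monom:
  fixes T :: "'a::field_char_0 poly \<Rightarrow> 'a poly"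
  assumes lin: "Vector_Spaces.linear smult smult T"
    and comm: "\<And>p. pderiv (T p) = T (pderiv p)"
  shows "T (monom 1 i) =
    (\<Sum>k=0..i. monom (coeff (T (monom 1 k)) 0 * of_nat (i choose k)) (i - k))"
proof (induction i)
  case 0
  have "T 0 = 0"
    using lin by (auto simp: Vector_Spaces.linear_iff dest: spec[of _ 0])
  then have "pderiv (T (monom 1 0)) = 0"
    by (simp add: comm pderiv_monom)
  then show ?case
    by (auto simp: pderiv_eq_0_iff monom_0 elim!: degree_eq_zeroE)
next
  case (Suc i)
  interpret vector_space "smult :: 'a \<Rightarrow> _" by (rule vector_space_poly)
  let ?c = "\<lambda>k. coeff (T (monom 1 k)) 0"
  have smult: "T (smult a p) = smult a (T p)" for a p
    using lin by (simp add: Vector_Spaces.linear_iff)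
  show ?case
  proof (rule poly_eqI_pderiv)
    have "pderiv (monom (1::'a) (Suc i)) = smult (of_nat (Suc i)) (monom 1 i)"
      by (simp add: pderiv_monom smult_monom)
    then have "pderiv (T (monom 1 (Suc i))) = smult (of_nat (Suc i)) (T (monom 1 i))"
      by (simp only: comm smult)
    also have "\<dots> = (\<Sum>k=0..i. monom (of_nat (Suc i) * (?c k * of_nat (i choose k))) (i - k))"
      by (subst Suc.IH) (simp add: scale_sum_right smult_monom)
    also have "\<dots> = (\<Sum>k=0..i. pderiv (monom (?c k * of_nat (Suc i choose k)) (Suc i - k)))"
    proof (rule sum.cong, goal_cases)
      case (2 k)
      then have "k \<le> i" by simp
      \<comment> \<open>Absorption: the factor on the right is the one produced by differentiating
        x^(i+1-k).\<close>
      have "Suc i * (i choose k) = (Suc i - k) * (Suc i choose k)"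
        using \<open>k \<le> i\<close> binomial_absorb_comp[of "Suc i" k] by simp
      then have "of_nat (Suc i) * of_nat (i choose k) =
          of_nat (Suc i - k) * (of_nat (Suc i choose k) :: 'a)"
        by (metis of_nat_mult)
      moreover have "Suc i - k - 1 = i - k"
        by simp
      ultimately show ?case
        by (simp add: pderiv_monom mult.left_commute)
    qed simp
    \<comment> \<open>The added summand \<open>k = Suc i\<close> is a constant, so its derivative is
      0; below it is the only one that contributes a constant term.\<close>
    also have "\<dots> = pderiv (\<Sum>k=0..Suc i. monom (?c k * of_nat (Suc i choose k)) (Suc i - k))"
      by (simp add: higher_pderiv_sum[of 1, simplified] pderiv_add pderiv_monom)
    finally show "pderiv (T (monom 1 (Suc i))) = \<dots>" .
  next
    have "(\<Sum>k=0..i. coeff (monom (?c k * of_nat (Suc i choose k)) (Suc i - k)) 0) = 0"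
      by (intro sum.neutral) auto
    then show "coeff (T (monom 1 (Suc i))) 0 =
      coeff (\<Sum>k=0..Suc i. monom (?c k * of_nat (Suc i choose k)) (Suc i - k)) 0"
      by (simp add: coeff_sum)
  qed
qed

lemma pderiv_commutator_monom:
  fixes \<Omega> :: "'a::field_char_0 poly \<Rightarrow> 'a poly"
  assumes lin: "Vector_Spaces.linear smult smult \<Omega>"
    and comm: "\<And>p. pderiv (\<Omega> p) = p + \<Omega> (pderiv p)"
  obtains c where "\<And>i. \<Omega> (monom 1 i) =
    monom 1 (i + 1) + (\<Sum>k=0..i. monom (c k * of_nat (i choose k)) (i - k))"
proof
  \<comment> \<open>\<open>pCons 0 p\<close> is x times p. It has no constant term, so the resulting
    c_k is also the constant term of \<Omega>(x^k).\<close>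
  let ?T = "\<lambda>p. \<Omega> p - pCons 0 p"
  fix i
  have "Vector_Spaces.linear smult smult ?T"
    using lin by (auto simp: Vector_Spaces.linear_iff smult_diff_right)
  moreover have "pderiv (?T p) = ?T (pderiv p)" for p
    by (simp add: pderiv_diff pderiv_pCons comm)
  ultimately have "?T (monom 1 i) =
      (\<Sum>k=0..i. monom (coeff (?T (monom 1 k)) 0 * of_nat (i choose k)) (i - k))"
    by (rule commutes_pderiv_monom)
  then show "\<Omega> (monom 1 i) = monom 1 (i + 1) +
      (\<Sum>k=0..i. monom (coeff (?T (monom 1 k)) 0 * of_nat (i choose k)) (i - k))"
    by (simp add: monom_Suc algebra_simps)
qed

lemma independent_monom: "\<not> module.dependent smult (range (monom (1::'a::field)))"
proof -
  interpret vector_space "smult :: 'a \<Rightarrow> _" by (rule vector_space_poly)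
  show ?thesis
    unfolding independent_explicit_module
  proof (intro allI impI)
    fix t :: "'a poly set" and u v
    assume t: "finite t" "t \<subseteq> range (monom 1)" "(\<Sum>v\<in>t. smult (u v) v) = 0" "v \<in> t"
    obtain n where n: "v = monom 1 n" using t by auto
    have "coeff (smult (u w) w) n = (if w = v then u v else 0)" if w: "w \<in> t" for w
    proof -
      obtain m where "w = monom 1 m" using w t(2) by auto
      with n show ?thesis by (auto simp: monom_eq_iff')
    qed
    then have "coeff (\<Sum>v\<in>t. smult (u v) v) n = (\<Sum>w\<in>t. if w = v then u v else 0)"
      unfolding coeff_sum by (rule sum.cong[OF refl])
    with t show "u v = 0" by simp
  qed
qed

text \<open>Serves to read off the row of products with the lift of x, and to see that the images of
  the monomials span the Leibniz kernel.\<close>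

lemma linear_poly_expansion:
  assumes "Vector_Spaces.linear smult s f"
  shows "f p = (\<Sum>j\<le>degree p. s (coeff p j) (f (monom 1 j)))"
proof -
  interpret Vector_Spaces.linear smult s f by fact
  have "f p = f (\<Sum>j\<le>degree p. smult (coeff p j) (monom 1 j))"
    by (subst poly_as_sum_of_monoms[of p, symmetric]) (simp add: smult_monom)
  then show ?thesis
    by (simp only: sum scale)
qed

section \<open>Passing from the quotient and the module to the Leibniz algebra itself\<close>

context leibniz_algebra
begin

lemma coset_eq_coset_0_iff: "coset x = coset 0 \<longleftrightarrow> x \<in> leib"
proof
  assume "coset x = coset 0"
  moreover have "x \<in> coset x"
    unfolding coset_def by (intro CollectI exI[of _ 0]) (simp add: leib_closed)
  ultimately show "x \<in> leib" by (auto simp: coset_def)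
next
  assume x: "x \<in> leib"
  have "coset x = {i. i \<in> leib}"
  proof (intro equalityI subsetI)
    fix z assume "z \<in> coset x"
    then show "z \<in> {i. i \<in> leib}" using x by (auto simp: coset_def leib_closed)
  next
    fix z assume "z \<in> {i. i \<in> leib}"
    then have "z - x \<in> leib"
      using x ideal_leib by (auto simp: ideal_def intro: subspace_diff)
    moreover have "z = x + (z - x)" by simp
    ultimately show "z \<in> coset x" unfolding coset_def by blast
  qed
  then show "coset x = coset 0" by (simp add: coset_def)
qed

text \<open>Replaces cosets by a linear map on the whole algebra, whose kernel is identified as
  \<open>leib\<close> in \<open>quot_iso_eq_0_iff\<close>.\<close>

lemma linear_quot_iso_coset:
  assumes "vector_space scale_g" and "quot_iso scale_g br_g \<phi>"
  shows "Vector_Spaces.linear scale scale_g (\<lambda>z. \<phi> (coset z))"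
  using assms
  by (auto simp: Vector_Spaces.linear_iff vector_space_axioms quot_iso_def quot_def
      simp flip: quot_add_coset quot_scale_coset)

lemma quot_iso_br:
  assumes "quot_iso scale_g br_g \<phi>"
  shows "\<phi> (coset (br x y)) = br_g (\<phi> (coset x)) (\<phi> (coset y))"
  using assms by (auto simp: quot_iso_def quot_def simp flip: quot_br_coset)

lemma quot_iso_eq_0_iff:
  assumes "vector_space scale_g" and "quot_iso scale_g br_g \<phi>"
  shows "\<phi> (coset z) = 0 \<longleftrightarrow> z \<in> leib"
proof -
  interpret \<pi>: Vector_Spaces.linear scale scale_g "\<lambda>z. \<phi> (coset z)"
    using assms by (rule linear_quot_iso_coset)
  have "inj_on \<phi> (range coset)"
    using assms(2) by (simp add: quot_iso_def quot_def bij_betw_def)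
  then have "\<phi> (coset z) = \<phi> (coset 0) \<longleftrightarrow> coset z = coset 0"
    by (rule inj_on_eq_iff) auto
  then show ?thesis
    by (simp add: \<pi>.zero coset_eq_coset_0_iff)
qed

lemma quot_iso_lift:
  assumes "quot_iso scale_g br_g \<phi>"
  obtains z where "\<phi> (coset z) = h"
proof -
  have "h \<in> \<phi> ` range coset"
    using assms by (simp add: quot_iso_def quot_def bij_betw_def)
  then show ?thesis using that by auto
qed

text \<open>The inverse is preferred to \<open>\<theta>\<close> because it is linear on a full type,
  while \<open>\<theta>\<close> is constrained only on \<open>leib\<close>.\<close>

lemma linear_inv_leib_module_iso:
  assumes "vector_space scale_m" and "leib_module_iso \<phi> scale_m act \<theta>"
  shows "Vector_Spaces.linear scale_m scale (inv_into leib \<theta>)"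
proof -
  let ?\<rho> = "inv_into leib \<theta>"
  have bij: "bij_betw \<theta> leib UNIV"
    and hom: "\<And>i j. i \<in> leib \<Longrightarrow> j \<in> leib \<Longrightarrow> \<theta> (i + j) = \<theta> i + \<theta> j"
      "\<And>c i. i \<in> leib \<Longrightarrow> \<theta> (scale c i) = scale_m c (\<theta> i)"
    using assms(2) by (auto simp: leib_module_iso_def)
  have mem: "?\<rho> p \<in> leib" and inv: "\<theta> (?\<rho> p) = p" for p
    using bij by (auto simp: bij_betw_def inv_into_into f_inv_into_f)
  have eqI: "?\<rho> p = i" if "i \<in> leib" "\<theta> i = p" for p i
    using that bij by (auto simp: bij_betw_def)
  show ?thesis
    unfolding Vector_Spaces.linear_iff
    by (intro conjI allI eqI vector_space_axioms assms(1))
      (simp_all add: mem inv hom leib_closed)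
qed

text \<open>A product with left factor in \<open>leib\<close> depends on the right factor only
  modulo \<open>leib\<close>, so it can be computed in the module.\<close>

lemma br_inv_leib_module_iso:
  assumes \<phi>: "quot_iso scale_g br_g \<phi>" and \<theta>: "leib_module_iso \<phi> scale_m act \<theta>"
  shows "br (inv_into leib \<theta> p) z = inv_into leib \<theta> (act p (\<phi> (coset z)))"
proof -
  let ?\<rho> = "inv_into leib \<theta>"
  have bij: "bij_betw \<theta> leib UNIV"
    and act: "\<And>i h. i \<in> leib \<Longrightarrow> \<theta> (induced_act \<phi> i h) = act (\<theta> i) h"
    using \<theta> by (auto simp: leib_module_iso_def)
  have mem: "?\<rho> p \<in> leib" and inv: "\<theta> (?\<rho> p) = p"
    using bij by (auto simp: bij_betw_def inv_into_into f_inv_into_f)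
  have "inv_into quot \<phi> (\<phi> (coset z)) = coset z"
    using \<phi> by (auto simp: quot_iso_def quot_def bij_betw_def)
  then have "br (?\<rho> p) z = induced_act \<phi> (?\<rho> p) (\<phi> (coset z))"
    by (simp add: induced_act_def quot_act_coset)
  then have "\<theta> (br (?\<rho> p) z) = act p (\<phi> (coset z))"
    by (simp add: act mem inv)
  moreover have "br (?\<rho> p) z \<in> leib"
    by (simp add: leib_closed mem)
  ultimately show ?thesis
    using bij by (metis bij_betw_def inv_into_f_f)
qed

text \<open>In other words, the kernel of right multiplication by a lift of 1 is a subalgebra
  complementary to \<open>leib\<close>, hence a copy of the quotient.\<close>

lemma quot_heis_basis:
  fixes \<phi> :: "'l set \<Rightarrow> 'f ^ 3"
  assumes \<phi>: "quot_iso ((*s)) heis_br \<phi>"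
    and unit: "\<And>i z. i \<in> leib \<Longrightarrow> \<phi> (coset z) = axis 1 1 \<Longrightarrow> br i z = i"
  obtains e1 ex ed where
    "\<phi> (coset e1) = axis 1 1" "\<phi> (coset ex) = axis 2 1" "\<phi> (coset ed) = axis 3 1"
    "br ex ed = e1" "br ed ex = - e1"
    "br e1 e1 = 0" "br e1 ex = 0" "br e1 ed = 0"
    "br ex e1 = 0" "br ex ex = 0" "br ed e1 = 0" "br ed ed = 0"
proof -
  define \<pi> where "\<pi> = (\<lambda>z. \<phi> (coset z))"
  interpret \<pi>: Vector_Spaces.linear scale "(*s)" \<pi>
    unfolding \<pi>_def using vec.vector_space_axioms \<phi> by (rule linear_quot_iso_coset)
  have br: "\<pi> (br x y) = heis_br (\<pi> x) (\<pi> y)" for x y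
    unfolding \<pi>_def using \<phi> by (rule quot_iso_br)
  have ker: "\<pi> z = 0 \<longleftrightarrow> z \<in> leib" for z
    unfolding \<pi>_def using vec.vector_space_axioms \<phi> by (rule quot_iso_eq_0_iff)
  obtain a1 where a1: "\<pi> a1 = axis 1 1"
    unfolding \<pi>_def using \<phi> by (rule quot_iso_lift)
  \<comment> \<open>The image of \<open>a1\<close> is central in the Heisenberg algebra.\<close>
  have br_a1: "br z a1 \<in> leib" for z
    by (simp add: br a1 heis_br_basis flip: ker)
  have lift: "\<exists>z. \<pi> z = h \<and> br z a1 = 0" for h
  proof -
    obtain a where a: "\<pi> a = h"
      unfolding \<pi>_def using \<phi> by (rule quot_iso_lift)
    \<comment> \<open>Right multiplication by \<open>a1\<close> fixes \<open>br a a1\<close>, so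
      subtracting it cancels the product. The form \<open>scale (- 1)\<close> lets
      \<open>br_simps\<close> apply.\<close>
    have "\<pi> (a + scale (- 1) (br a a1)) = h"
      using br_a1[of a] by (simp add: \<pi>.diff a flip: ker)
    moreover have "br (a + scale (- 1) (br a a1)) a1 = 0"
      using br_a1[of a] a1 by (simp only: br_simps unit \<pi>_def) simp
    ultimately show ?thesis by blast
  qed
  \<comment> \<open>In the Leibniz identity the other term is \<open>br z (br w a1)\<close>, which
    vanishes by \<open>br_leib\<close>; hence \<open>w\<close> may be arbitrary.\<close>
  have br_closed: "br (br z w) a1 = 0" if "br z a1 = 0" for z w
    using that br_a1 by (simp add: leibniz[of z w a1] br_simps br_leib)
  have eq_0: "z = 0" if "br z a1 = 0" "\<pi> z = 0" for z
    using that a1 unit[of z a1] ker[of z] by (simp add: \<pi>_def)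
  obtain ex ed where ex: "\<pi> ex = axis 2 1" "br ex a1 = 0" and ed: "\<pi> ed = axis 3 1" "br ed a1 = 0"
    using lift by blast
  \<comment> \<open>The lift \<open>a1\<close> itself need not satisfy \<open>br a1 a1 = 0\<close>,
    whereas this product does by \<open>br_closed\<close>.\<close>
  define e1 where "e1 = br ex ed"
  have e1: "\<pi> e1 = axis 1 1" "br e1 a1 = 0"
    by (simp_all add: e1_def br_closed ex ed br heis_br_basis)
  have "br ed ex + e1 = 0"
    by (rule eq_0) (simp_all add: br_simps br_closed ex ed e1 br \<pi>.add heis_br_basis)
  then have "br ed ex = - e1"
    by (simp add: eq_neg_iff_add_eq_0)
  \<comment> \<open>Yields all the zero entries at once; only the left factor has to be annihilated
    by \<open>a1\<close>.\<close>
  moreover have "br u v = 0" if "br u a1 = 0" "heis_br (\<pi> u) (\<pi> v) = 0" for u v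
    by (rule eq_0) (simp_all add: that br_closed br)
  ultimately show ?thesis
    using e1 ex ed e1_def by (intro that[of e1 ex ed]) (simp_all add: \<pi>_def heis_br_basis)
qed

end

section \<open>The basis and its multiplication table\<close>

theorem proposition3:
  fixes \<Omega> :: "'f::{alg_closed_field, field_char_0} poly \<Rightarrow> 'f poly"
    and scale :: "'f \<Rightarrow> 'l::ab_group_add \<Rightarrow> 'l"
    and br :: "'l \<Rightarrow> 'l \<Rightarrow> 'l"
  assumes "Vector_Spaces.linear smult smult \<Omega>"
    and "right_lie_module ((*s)) heis_br smult (psi2 \<Omega>)"
    and "leibniz_algebra scale br"
    and "leibniz_algebra.quot_iso scale br ((*s)) heis_br \<phi>"
    and "leibniz_algebra.leib_module_iso scale br \<phi> smult (psi2 \<Omega>) \<theta>"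
  shows "\<exists>e\<^sub>1 e\<^sub>x e\<^sub>\<delta> (X :: nat \<Rightarrow> 'l) (c :: nat \<Rightarrow> 'f).
    distinct [e\<^sub>1, e\<^sub>x, e\<^sub>\<delta>] \<and> inj X \<and> {e\<^sub>1, e\<^sub>x, e\<^sub>\<delta>} \<inter> range X = {} \<and>
    \<not> module.dependent scale ({e\<^sub>1, e\<^sub>x, e\<^sub>\<delta>} \<union> range X) \<and>
    module.span scale ({e\<^sub>1, e\<^sub>x, e\<^sub>\<delta>} \<union> range X) = UNIV \<and>
    module.span scale (range X) = leibniz_algebra.leib scale br \<and>
    (\<forall>i. br (X i) e\<^sub>1 = X i) \<and>
    (\<forall>i. br (X i) e\<^sub>x =
      (\<Sum>j\<le>degree (\<Omega> (monom 1 i)). scale (coeff (\<Omega> (monom 1 i)) j) (X j))) \<and>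
    (\<forall>i. br (X i) e\<^sub>\<delta> = scale (of_nat i) (X (i - 1))) \<and>
    br e\<^sub>x e\<^sub>\<delta> = e\<^sub>1 \<and> br e\<^sub>\<delta> e\<^sub>x = - e\<^sub>1 \<and>
    br e\<^sub>1 e\<^sub>1 = 0 \<and> br e\<^sub>1 e\<^sub>x = 0 \<and> br e\<^sub>1 e\<^sub>\<delta> = 0 \<and>
    br e\<^sub>x e\<^sub>1 = 0 \<and> br e\<^sub>x e\<^sub>x = 0 \<and> br e\<^sub>\<delta> e\<^sub>1 = 0 \<and> br e\<^sub>\<delta> e\<^sub>\<delta> = 0 \<and>
    (\<forall>i. br e\<^sub>1 (X i) = 0 \<and> br e\<^sub>x (X i) = 0 \<and> br e\<^sub>\<delta> (X i) = 0) \<and>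
    (\<forall>i j. br (X i) (X j) = 0) \<and>
    (\<forall>i. \<Omega> (monom 1 i) =
      monom 1 (i + 1) + (\<Sum>k=0..i. monom (c k * of_nat (i choose k)) (i - k)))"
proof -
  interpret leibniz_algebra scale br by fact
  interpret M: right_lie_module "(*s)" heis_br smult "psi2 \<Omega>" by fact
  define \<pi> where "\<pi> = (\<lambda>z. \<phi> (coset z))"
  define \<rho> where "\<rho> = inv_into leib \<theta>"
  interpret \<pi>: Vector_Spaces.linear scale "(*s)" \<pi>
    unfolding \<pi>_def using vec.vector_space_axioms assms(4) by (rule linear_quot_iso_coset)
  interpret \<rho>: Vector_Spaces.linear smult scale \<rho>
    unfolding \<rho>_def using vector_space_poly assms(5) by (rule linear_inv_leib_module_iso)
  have ker: "\<pi> z = 0 \<longleftrightarrow> z \<in> leib" for z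
    unfolding \<pi>_def using vec.vector_space_axioms assms(4) by (rule quot_iso_eq_0_iff)
  have bij: "bij_betw \<rho> UNIV leib"
    using assms(5) by (auto simp: \<rho>_def leib_module_iso_def intro: bij_betw_inv_into)
  have br_\<rho>: "br (\<rho> p) z = \<rho> (psi2 \<Omega> p (\<pi> z))" for p z
    unfolding \<pi>_def \<rho>_def using assms(4,5) by (rule br_inv_leib_module_iso)

  \<comment> \<open>The module law at the pair x, d/dx, whose bracket acts as the identity.\<close>
  have "pderiv (\<Omega> p) = p + \<Omega> (pderiv p)" for p
    using M.act_br[of p "axis 2 1" "axis 3 1"] by (simp add: heis_br_basis psi2_basis algebra_simps)
  with assms(1) obtain c where c: "\<And>i. \<Omega> (monom 1 i) =
      monom 1 (i + 1) + (\<Sum>k=0..i. monom (c k * of_nat (i choose k)) (i - k))"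
    by (rule pderiv_commutator_monom) blast

  \<comment> \<open>The hypothesis \<open>unit\<close> of \<open>quot_heis_basis\<close>:
    \<open>psi2\<close> lets the first basis vector act as the identity.\<close>
  have "br i z = i" if i: "i \<in> leib" and z: "\<phi> (coset z) = axis 1 1" for i z
  proof -
    obtain p where "i = \<rho> p"
      using bij i by (metis bij_betw_imp_surj_on imageE)
    then show ?thesis
      using z br_\<rho>[of p z] by (simp add: \<pi>_def psi2_basis)
  qed
  then obtain e1 ex ed where e: "\<phi> (coset e1) = axis 1 1" "\<phi> (coset ex) = axis 2 1"
      "\<phi> (coset ed) = axis 3 1"
    and table: "br ex ed = e1" "br ed ex = - e1"
      "br e1 e1 = 0" "br e1 ex = 0" "br e1 ed = 0"
      "br ex e1 = 0" "br ex ex = 0" "br ed e1 = 0" "br ed ed = 0"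
    using quot_heis_basis[OF assms(4)] by blast
  have \<pi>_e: "\<pi> e1 = axis 1 1" "\<pi> ex = axis 2 1" "\<pi> ed = axis 3 1"
    using e by (simp_all add: \<pi>_def)

  define X where "X = (\<lambda>i. \<rho> (monom 1 i))"
  have \<rho>_expand: "\<rho> p = (\<Sum>j\<le>degree p. scale (coeff p j) (X j))" for p
    unfolding X_def by (rule linear_poly_expansion[OF \<rho>.linear_axioms])
  have X_leib: "X i \<in> leib" for i
    using bij by (auto simp: X_def bij_betw_def)
  have \<pi>_X: "\<pi> (X i) = 0" for i
    by (simp add: ker X_leib)
  have inj_\<rho>: "inj \<rho>"
    using bij by (simp add: bij_betw_def)
  have inj_X: "inj X"
    by (rule injI) (simp add: X_def inj_eq[OF inj_\<rho>] monom_eq_iff')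
  have indep_X: "\<not> dependent (range X)"
  proof -
    interpret pair: vector_space_pair smult scale ..
    have "\<not> dependent (\<rho> ` range (monom 1))"
      using \<rho>.linear_axioms independent_monom inj_\<rho>
      by (intro pair.linear_independent_injective_image) (auto intro: inj_on_subset)
    then show ?thesis by (simp add: X_def image_image)
  qed
  have span_X: "span (range X) = leib"
  proof
    show "span (range X) \<subseteq> leib"
      using ideal_leib X_leib by (intro span_minimal) (auto simp: ideal_def)
    show "leib \<subseteq> span (range X)"
    proof
      fix i assume "i \<in> leib"
      then obtain p where "i = \<rho> p"
        using bij by (metis bij_betw_imp_surj_on imageE)
      then show "i \<in> span (range X)"
        by (simp only: \<rho>_expand) (intro span_sum span_scale span_base rangeI)
    qed
  qed
  have sub: "subspace {z. \<pi> z $ k = 0}" for k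
    by (auto simp: subspace_def \<pi>.zero \<pi>.add \<pi>.scale)
  \<comment> \<open>Independence is tested by coordinates of \<open>\<pi>\<close>: each vector
    adjoined below has a nonzero coordinate that vanishes on all earlier ones.\<close>
  have not_span: "z \<notin> span S" if "\<And>y. y \<in> S \<Longrightarrow> \<pi> y $ k = 0" "\<pi> z $ k \<noteq> 0" for z S k
  proof -
    have "span S \<subseteq> {z. \<pi> z $ k = 0}"
      using that(1) sub by (intro span_minimal) auto
    then show ?thesis using that(2) by auto
  qed
  have "ed \<notin> span (range X)"
    by (rule not_span[of _ 3]) (auto simp: \<pi>_e \<pi>_X axis_def)
  moreover have "ex \<notin> span (insert ed (range X))"
    by (rule not_span[of _ 2]) (auto simp: \<pi>_e \<pi>_X axis_def)
  moreover have "e1 \<notin> span (insert ex (insert ed (range X)))"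
    by (rule not_span[of _ 1]) (auto simp: \<pi>_e \<pi>_X axis_def)
  ultimately have "\<not> dependent (insert e1 (insert ex (insert ed (range X))))"
    using indep_X by (intro independent_insertI)
  then have indep: "\<not> dependent ({e1, ex, ed} \<union> range X)"
    by simp
  have spans: "span ({e1, ex, ed} \<union> range X) = UNIV"
  proof (intro equalityI subsetI UNIV_I)
    fix z
    let ?B = "{e1, ex, ed} \<union> range X"
    \<comment> \<open>The combination of the three lifts with the same image as \<open>z\<close>, so
      the remainder lies in \<open>leib\<close>.\<close>
    define w where "w = scale (\<pi> z $ 1) e1 + scale (\<pi> z $ 2) ex + scale (\<pi> z $ 3) ed"
    have "\<pi> (z - w) = 0"
      by (simp add: w_def \<pi>.diff \<pi>.add \<pi>.scale \<pi>_e vec_eq_iff forall_3 axis_def)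
    then have "z - w \<in> span (range X)"
      by (simp add: ker span_X)
    then have "z - w \<in> span ?B"
      using span_mono[of "range X" ?B] by blast
    moreover have "w \<in> span ?B"
      unfolding w_def by (intro span_add span_scale span_base) auto
    ultimately have "z - w + w \<in> span ?B"
      by (rule span_add)
    then show "z \<in> span ?B" by simp
  qed
  have dist: "distinct [e1, ex, ed]"
  proof -
    have "distinct (map \<pi> [e1, ex, ed])"
      by (simp add: \<pi>_e axis_eq_axis)
    then show ?thesis by (simp only: distinct_map)
  qed
  have disj: "{e1, ex, ed} \<inter> range X = {}"
  proof -
    have "\<pi> y \<noteq> 0" if "y \<in> {e1, ex, ed}" for y
      using that by (auto simp: \<pi>_e)
    then show ?thesis using \<pi>_X by fastforce
  qed
  \<comment> \<open>For \<open>i = 0\<close> the truncated index \<open>i - 1\<close> is harmless,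
    since its scalar is 0.\<close>
  have X_e: "br (X i) e1 = X i" "br (X i) ex = \<rho> (\<Omega> (monom 1 i))"
    "br (X i) ed = scale (of_nat i) (X (i - 1))" for i
    by (simp_all add: X_def br_\<rho> \<pi>_e psi2_basis pderiv_monom smult_monom flip: \<rho>.scale)
  \<comment> \<open>All products with some \<open>X i\<close> on the right vanish by
    \<open>br_leib\<close>.\<close>
  show ?thesis
    by (intro exI[of _ e1] exI[of _ ex] exI[of _ ed] exI[of _ X] exI[of _ c] conjI allI
        dist inj_X disj indep spans span_X table c br_leib X_leib X_e(1,3))
      (simp add: X_e \<rho>_expand)
qed

end
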